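(* Let $(A,\sigma)$ be a subdirectly irreducible state BL-algebra. Then $\sigma(A)$ is linearly ordered. Moreover, if $\mathrm{Ker}(\sigma)=\{1\}$, then $(A,\sigma)$ is subdirectly irreducible if and only if the BL-algebra $\sigma(A)$ is subdirectly irreducible.
   Context: A BL-algebra is an algebra $(A,\wedge,\vee,\odot,\to,0,1)$ of type $(2,2,2,2,0,0)$ such that $(A,\wedge,\vee,0,1)$ is a bounded lattice, $(A,\odot,1)$ is a commutative monoid, and for all $a,b,c\in A$: $c\le a\to b$ iff $a\odot c\le b$; $a\wedge b=a\odot(a\to b)$; $(a\to b)\vee(b\to a)=1$. A state-operator on $A$ is a map $\sigma:A\to A$ such that for all $x,y\in A$: (1) $\sigma(0)=0$; (2) $\sigma(x\to y)=\sigma(x)\to\sigma(x\wedge y)$; (3) $\sigma(x\odot y)=\sigma(x)\odot\sigma(x\to x\odot y)$; (4) $\sigma(\sigma(x)\odot\sigma(y))=\sigma(x)\odot\sigma(y)$; (5) $\sigma(\sigma(x)\to\sigma(y))=\sigma(x)\to\sigma(y)$; $(A,\sigma)$ is then a state BL-algebra. The image $\sigma(A)$ is a subalgebra of $A$ and is regarded as a BL-algebra. $\mathrm{Ker}(\sigma)=\{x\in A:\sigma(x)=1\}$. A filter of a BL-algebra is a nonempty subset closed under $\odot$ and upward closed; a state-filter of $(A,\sigma)$ is a filter $F$ of $A$ with $\sigma(x)\in F$ whenever $x\in F$. State-filters correspond bijectively to congruences of the state BL-algebra (via $x\sim_F y$ iff $x\to y,\,y\to x\in F$). $(A,\sigma)$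 is subdirectly irreducible if it has a least state-filter different from $\{1\}$ (equivalently, a least nontrivial congruence); a BL-algebra is subdirectly irreducible if it has a least filter different from $\{1\}$. *)

theory Defs
  imports "HOL-Algebra.Group"
begin

text \<open>
  The monoid operation and the constant 1 of a BL-algebra are the fields \<open>mult\<close> and \<open>one\<close>
  inherited from \<open>monoid\<close>.
\<close>

record 'a bl_structure = "'a monoid" +
  bl_meet :: "'a \<Rightarrow> 'a \<Rightarrow> 'a" (infixl "\<curlywedge>\<index>" 70)
  bl_join :: "'a \<Rightarrow> 'a \<Rightarrow> 'a" (infixl "\<curlyvee>\<index>" 65)
  bl_imp  :: "'a \<Rightarrow> 'a \<Rightarrow> 'a" (infixr "\<leadsto>\<index>" 60)
  bl_zero :: 'a

definition bl_le :: "('a, 'm) bl_structure_scheme \<Rightarrow> 'a \<Rightarrow> 'a \<Rightarrow> bool" (infix "\<preceq>\<index>" 50)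
  where "x \<preceq>\<^bsub>A\<^esub> y \<longleftrightarrow> x \<curlywedge>\<^bsub>A\<^esub> y = x"

locale bl_algebra = comm_monoid A
  for A :: "('a, 'm) bl_structure_scheme" (structure) +
  assumes meet_closed: "\<lbrakk>x \<in> carrier A; y \<in> carrier A\<rbrakk> \<Longrightarrow> x \<curlywedge> y \<in> carrier A"
    and join_closed: "\<lbrakk>x \<in> carrier A; y \<in> carrier A\<rbrakk> \<Longrightarrow> x \<curlyvee> y \<in> carrier A"
    and imp_closed: "\<lbrakk>x \<in> carrier A; y \<in> carrier A\<rbrakk> \<Longrightarrow> x \<leadsto> y \<in> carrier A"
    and zero_closed: "bl_zero A \<in> carrier A"
    and meet_assoc: "\<lbrakk>x \<in> carrier A; y \<in> carrier A; z \<in> carrier A\<rbrakk>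
          \<Longrightarrow> (x \<curlywedge> y) \<curlywedge> z = x \<curlywedge> (y \<curlywedge> z)"
    and meet_comm: "\<lbrakk>x \<in> carrier A; y \<in> carrier A\<rbrakk> \<Longrightarrow> x \<curlywedge> y = y \<curlywedge> x"
    and join_assoc: "\<lbrakk>x \<in> carrier A; y \<in> carrier A; z \<in> carrier A\<rbrakk>
          \<Longrightarrow> (x \<curlyvee> y) \<curlyvee> z = x \<curlyvee> (y \<curlyvee> z)"
    and join_comm: "\<lbrakk>x \<in> carrier A; y \<in> carrier A\<rbrakk> \<Longrightarrow> x \<curlyvee> y = y \<curlyvee> x"
    and meet_join_absorb: "\<lbrakk>x \<in> carrier A; y \<in> carrier A\<rbrakk> \<Longrightarrow> x \<curlywedge> (x \<curlyvee> y) = x"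
    and join_meet_absorb: "\<lbrakk>x \<in> carrier A; y \<in> carrier A\<rbrakk> \<Longrightarrow> x \<curlyvee> (x \<curlywedge> y) = x"
    and zero_least: "x \<in> carrier A \<Longrightarrow> bl_zero A \<preceq> x"
    and one_greatest: "x \<in> carrier A \<Longrightarrow> x \<preceq> \<one>"
    and residuation: "\<lbrakk>a \<in> carrier A; b \<in> carrier A; c \<in> carrier A\<rbrakk>
          \<Longrightarrow> c \<preceq> a \<leadsto> b \<longleftrightarrow> a \<otimes> c \<preceq> b"
    and divisibility: "\<lbrakk>a \<in> carrier A; b \<in> carrier A\<rbrakk> \<Longrightarrow> a \<curlywedge> b = a \<otimes> (a \<leadsto> b)"
    and prelinearity: "\<lbrakk>a \<in> carrier A; b \<in> carrier A\<rbrakk> \<Longrightarrow> (a \<leadsto> b) \<curlyvee> (b \<leadsto> a) = \<one>"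

locale state_bl_algebra = bl_algebra A
  for A :: "('a, 'm) bl_structure_scheme" (structure) +
  fixes \<sigma> :: "'a \<Rightarrow> 'a"
  assumes state_closed: "\<sigma> \<in> carrier A \<rightarrow> carrier A"
    and state_zero: "\<sigma> (bl_zero A) = bl_zero A"
    and state_imp: "\<lbrakk>x \<in> carrier A; y \<in> carrier A\<rbrakk>
          \<Longrightarrow> \<sigma> (x \<leadsto> y) = \<sigma> x \<leadsto> \<sigma> (x \<curlywedge> y)"
    and state_mult: "\<lbrakk>x \<in> carrier A; y \<in> carrier A\<rbrakk>
          \<Longrightarrow> \<sigma> (x \<otimes> y) = \<sigma> x \<otimes> \<sigma> (x \<leadsto> x \<otimes> y)"
    and state_mult_image: "\<lbrakk>x \<in> carrier A; y \<in> carrier A\<rbrakk>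
          \<Longrightarrow> \<sigma> (\<sigma> x \<otimes> \<sigma> y) = \<sigma> x \<otimes> \<sigma> y"
    and state_imp_image: "\<lbrakk>x \<in> carrier A; y \<in> carrier A\<rbrakk>
          \<Longrightarrow> \<sigma> (\<sigma> x \<leadsto> \<sigma> y) = \<sigma> x \<leadsto> \<sigma> y"

definition bl_linear :: "('a, 'm) bl_structure_scheme \<Rightarrow> bool"
  where "bl_linear A \<longleftrightarrow> (\<forall>x\<in>carrier A. \<forall>y\<in>carrier A. x \<preceq>\<^bsub>A\<^esub> y \<or> y \<preceq>\<^bsub>A\<^esub> x)"

definition bl_filter :: "('a, 'm) bl_structure_scheme \<Rightarrow> 'a set \<Rightarrow> bool"
  where "bl_filter A F \<longleftrightarrow> F \<subseteq> carrier A \<and> F \<noteq> {} \<and>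
    (\<forall>x\<in>F. \<forall>y\<in>F. x \<otimes>\<^bsub>A\<^esub> y \<in> F) \<and>
    (\<forall>x\<in>F. \<forall>y\<in>carrier A. x \<preceq>\<^bsub>A\<^esub> y \<longrightarrow> y \<in> F)"

definition state_filter :: "('a, 'm) bl_structure_scheme \<Rightarrow> ('a \<Rightarrow> 'a) \<Rightarrow> 'a set \<Rightarrow> bool"
  where "state_filter A \<sigma> F \<longleftrightarrow> bl_filter A F \<and> (\<forall>x\<in>F. \<sigma> x \<in> F)"

definition bl_subdirectly_irreducible :: "('a, 'm) bl_structure_scheme \<Rightarrow> bool"
  where "bl_subdirectly_irreducible A \<longleftrightarrow>
    (\<exists>F. bl_filter A F \<and> F \<noteq> {\<one>\<^bsub>A\<^esub>} \<and>
      (\<forall>G. bl_filter A G \<and> G \<noteq> {\<one>\<^bsub>A\<^esub>} \<longrightarrow> F \<subseteq> G))"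

definition state_subdirectly_irreducible ::
    "('a, 'm) bl_structure_scheme \<Rightarrow> ('a \<Rightarrow> 'a) \<Rightarrow> bool"
  where "state_subdirectly_irreducible A \<sigma> \<longleftrightarrow>
    (\<exists>F. state_filter A \<sigma> F \<and> F \<noteq> {\<one>\<^bsub>A\<^esub>} \<and>
      (\<forall>G. state_filter A \<sigma> G \<and> G \<noteq> {\<one>\<^bsub>A\<^esub>} \<longrightarrow> F \<subseteq> G))"

definition state_kernel :: "('a, 'm) bl_structure_scheme \<Rightarrow> ('a \<Rightarrow> 'a) \<Rightarrow> 'a set"
  where "state_kernel A \<sigma> = {x \<in> carrier A. \<sigma> x = \<one>\<^bsub>A\<^esub>}"

text \<open>The subalgebra on the image of the state-operator, with the operations of the ambient algebra.\<close>

definition state_image ::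
    "('a, 'm) bl_structure_scheme \<Rightarrow> ('a \<Rightarrow> 'a) \<Rightarrow> ('a, 'm) bl_structure_scheme"
  where "state_image A \<sigma> = A\<lparr>carrier := \<sigma> ` carrier A\<rparr>"

end

theory Submission
  imports Defs
begin

text \<open>
  If \<open>\<sigma> x\<close> and \<open>\<sigma> y\<close> were incomparable, then \<open>\<sigma> x \<leadsto> \<sigma> y\<close> and \<open>\<sigma> y \<leadsto> \<sigma> x\<close> would be
  \<open>\<sigma>\<close>-fixed elements different from 1, so the filters they generate would be nontrivial
  state-filters. By prelinearity these two filters meet only in 1, contradicting the existence of
  a least nontrivial state-filter. For the equivalence, \<open>F \<mapsto> F \<inter> \<sigma>(A)\<close> and upward closure in \<open>A\<close>
  translate between state-filters of \<open>A\<close> and filters of \<open>\<sigma>(A)\<close>; the triviality of the kernel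
  ensures that nontrivial state-filters have nontrivial traces.
\<close>

section \<open>Order, residuation and generated filters in a BL-algebra\<close>

context bl_algebra
begin

lemma le_refl: "x \<in> carrier A \<Longrightarrow> x \<preceq> x"
  unfolding bl_le_def by (metis join_meet_absorb meet_closed meet_join_absorb)

lemma le_trans:
  "\<lbrakk>x \<preceq> y; y \<preceq> z; x \<in> carrier A; y \<in> carrier A; z \<in> carrier A\<rbrakk> \<Longrightarrow> x \<preceq> z"
  unfolding bl_le_def by (metis meet_assoc)

lemma le_antisym: "\<lbrakk>x \<preceq> y; y \<preceq> x; x \<in> carrier A; y \<in> carrier A\<rbrakk> \<Longrightarrow> x = y"
  unfolding bl_le_def by (metis meet_comm)

lemma one_le_iff: "x \<in> carrier A \<Longrightarrow> \<one> \<preceq> x \<longleftrightarrow> x = \<one>"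
  using le_antisym one_greatest one_closed by blast

lemma le_join_left: "\<lbrakk>x \<in> carrier A; y \<in> carrier A\<rbrakk> \<Longrightarrow> x \<preceq> x \<curlyvee> y"
  unfolding bl_le_def by (rule meet_join_absorb)

lemma le_join_right: "\<lbrakk>x \<in> carrier A; y \<in> carrier A\<rbrakk> \<Longrightarrow> y \<preceq> x \<curlyvee> y"
  using le_join_left join_comm by metis

lemma le_imp_join_eq:
  assumes "x \<preceq> z" "x \<in> carrier A" "z \<in> carrier A"
  shows "x \<curlyvee> z = z"
  using assms unfolding bl_le_def by (metis join_comm join_meet_absorb meet_comm)

lemma join_least:
  assumes "x \<preceq> z" "y \<preceq> z" and c: "x \<in> carrier A" "y \<in> carrier A" "z \<in> carrier A"
  shows "x \<curlyvee> y \<preceq> z"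
proof -
  have "(x \<curlyvee> y) \<curlyvee> z = z"
    using assms by (simp add: join_assoc le_imp_join_eq)
  then show ?thesis
    using c by (metis join_closed le_join_left)
qed

lemma le_iff_imp_eq_one:
  assumes "x \<in> carrier A" "y \<in> carrier A"
  shows "x \<preceq> y \<longleftrightarrow> x \<leadsto> y = \<one>"
  using residuation[of x y \<one>] one_le_iff[of "x \<leadsto> y"] imp_closed assms by simp

lemma mult_mono_right:
  assumes "x \<preceq> y" and c: "x \<in> carrier A" "y \<in> carrier A" "z \<in> carrier A"
  shows "z \<otimes> x \<preceq> z \<otimes> y"
proof -
  have "y \<preceq> z \<leadsto> z \<otimes> y"
    using c by (simp add: residuation le_refl)
  then have "x \<preceq> z \<leadsto> z \<otimes> y"
    using assms le_trans by (meson imp_closed m_closed)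
  then show ?thesis
    using c by (simp add: residuation)
qed

lemma mult_mono:
  assumes "x \<preceq> y" "u \<preceq> v" and c: "x \<in> carrier A" "y \<in> carrier A" "u \<in> carrier A" "v \<in> carrier A"
  shows "x \<otimes> u \<preceq> y \<otimes> v"
proof -
  have "x \<otimes> u \<preceq> x \<otimes> v" "x \<otimes> v \<preceq> y \<otimes> v"
    using mult_mono_right[of u v x] mult_mono_right[of x y v] assms by (simp_all add: m_comm)
  then show ?thesis
    using c by (blast intro: le_trans m_closed)
qed

lemma mult_le_left: "\<lbrakk>x \<in> carrier A; y \<in> carrier A\<rbrakk> \<Longrightarrow> x \<otimes> y \<preceq> x"
  using mult_mono_right[of y \<one> x] one_greatest by simp

lemma mult_le_right: "\<lbrakk>x \<in> carrier A; y \<in> carrier A\<rbrakk> \<Longrightarrow> x \<otimes> y \<preceq> y"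
  using mult_le_left[of y x] by (simp add: m_comm)

text \<open>Residuation replaces distributivity of \<open>\<otimes>\<close> over joins. For
  \<open>t\<close> above \<open>u \<otimes> v\<close> and \<open>w\<close>, both \<open>u\<close>
  and \<open>w\<close> lie below \<open>v \<leadsto> t\<close>, hence so does their join 1. This
  gives \<open>v \<preceq> t\<close>, and then \<open>v \<curlyvee> w = \<one>\<close> forces
  \<open>t = \<one>\<close>.\<close>

lemma mult_join_eq_one:
  assumes "u \<curlyvee> w = \<one>" "v \<curlyvee> w = \<one>"
    and c: "u \<in> carrier A" "v \<in> carrier A" "w \<in> carrier A"
  shows "(u \<otimes> v) \<curlyvee> w = \<one>"
proof -
  define t where "t = (u \<otimes> v) \<curlyvee> w"
  have t: "t \<in> carrier A" "u \<otimes> v \<preceq> t" "w \<preceq> t"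
    using c by (simp_all add: t_def join_closed le_join_left le_join_right)
  have "v \<otimes> w \<preceq> t"
    using c t mult_le_right[of v w] by (blast intro: le_trans m_closed)
  then have "u \<preceq> v \<leadsto> t" "w \<preceq> v \<leadsto> t"
    using c t by (simp_all add: residuation m_comm)
  then have "u \<curlyvee> w \<preceq> v \<leadsto> t"
    using c t by (simp add: join_least imp_closed)
  then have "v \<preceq> t"
    using assms(1) c t by (simp add: residuation)
  then have "v \<curlyvee> w \<preceq> t"
    using c t by (simp add: join_least)
  then show ?thesis
    using assms(2) t(1) by (simp add: one_le_iff t_def)
qed

text \<open>This is what carries prelinearity from two elements to arbitrary powers of them.\<close>

lemma pow_join_eq_one:
  fixes n :: nat
  assumes "u \<curlyvee> w = \<one>" and c: "u \<in> carrier A" "w \<in> carrier A"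
  shows "(u [^] n) \<curlyvee> w = \<one>"
proof (induction n)
  case 0
  then show ?case
    using c one_le_iff[of "\<one> \<curlyvee> w"] by (simp add: le_join_left join_closed)
next
  case (Suc n)
  then show ?case
    using assms by (simp add: mult_join_eq_one)
qed

lemma one_in_filter: "bl_filter A F \<Longrightarrow> \<one> \<in> F"
  unfolding bl_filter_def by (meson all_not_in_conv one_closed one_greatest subsetD)

text \<open>For nonempty \<open>G\<close> closed under \<open>\<otimes>\<close> this is the filter
  generated by \<open>G\<close>. It is used for the powers of one element and for filters of the
  image of \<sigma>.\<close>

definition up_closure :: "'a set \<Rightarrow> 'a set"
  where "up_closure G = {z \<in> carrier A. \<exists>g\<in>G. g \<preceq> z}"

lemma subset_up_closure: "G \<subseteq> carrier A \<Longrightarrow> G \<subseteq> up_closure G"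
  using le_refl by (auto simp: up_closure_def)

lemma bl_filter_up_closure:
  assumes G: "G \<subseteq> carrier A" "G \<noteq> {}" and mult: "\<And>x y. \<lbrakk>x \<in> G; y \<in> G\<rbrakk> \<Longrightarrow> x \<otimes> y \<in> G"
  shows "bl_filter A (up_closure G)"
  unfolding bl_filter_def
proof (intro conjI ballI impI)
  show "up_closure G \<subseteq> carrier A" by (auto simp: up_closure_def)
  show "up_closure G \<noteq> {}" using G subset_up_closure by blast
next
  fix x y assume "x \<in> up_closure G" "y \<in> up_closure G"
  then obtain g h where gh: "g \<in> G" "h \<in> G" "g \<preceq> x" "h \<preceq> y"
    and c: "x \<in> carrier A" "y \<in> carrier A"
    by (auto simp: up_closure_def)
  then have "g \<otimes> h \<preceq> x \<otimes> y"
    using G(1) by (blast intro: mult_mono)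
  then show "x \<otimes> y \<in> up_closure G"
    using gh c mult by (auto simp: up_closure_def)
next
  fix x y assume "x \<in> up_closure G" "y \<in> carrier A" "x \<preceq> y"
  then show "y \<in> up_closure G"
    using G(1) by (auto simp: up_closure_def intro: le_trans)
qed

end

section \<open>State-operators, their image and generated state-filters\<close>

context state_bl_algebra
begin

lemma state_in_carrier [simp]: "x \<in> carrier A \<Longrightarrow> \<sigma> x \<in> carrier A"
  using state_closed by auto

lemma state_one: "\<sigma> \<one> = \<one>"
proof -
  have "bl_zero A \<leadsto> bl_zero A = \<one>" "bl_zero A \<curlywedge> bl_zero A = bl_zero A"
    using le_iff_imp_eq_one zero_closed zero_least by (auto simp: bl_le_def)
  then show ?thesis
    using state_imp[OF zero_closed zero_closed] by (simp add: state_zero)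
qed

lemma state_idem: "x \<in> carrier A \<Longrightarrow> \<sigma> (\<sigma> x) = \<sigma> x"
  using state_mult_image[of \<one> x] by (simp add: state_one)

text \<open>By divisibility \<open>x\<close> is a multiple of \<open>y\<close>, and the product
  axiom then makes \<open>\<sigma> y\<close> a factor of \<open>\<sigma> x\<close>.\<close>

lemma state_mono:
  assumes "x \<preceq> y" and c: "x \<in> carrier A" "y \<in> carrier A"
  shows "\<sigma> x \<preceq> \<sigma> y"
proof -
  have "x = y \<otimes> (y \<leadsto> x)"
    using assms by (metis bl_le_def divisibility meet_comm)
  then have "\<sigma> x = \<sigma> y \<otimes> \<sigma> (y \<leadsto> x)"
    using state_mult[of y "y \<leadsto> x"] c by (simp add: imp_closed)
  then show ?thesis
    using c by (simp add: mult_le_left imp_closed)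
qed

lemma mem_state_image_iff: "x \<in> \<sigma> ` carrier A \<longleftrightarrow> x \<in> carrier A \<and> \<sigma> x = x"
proof
  show "x \<in> carrier A \<and> \<sigma> x = x" if "x \<in> \<sigma> ` carrier A"
    using that by (auto simp: state_idem)
  show "x \<in> \<sigma> ` carrier A" if "x \<in> carrier A \<and> \<sigma> x = x"
    using that by (metis imageI)
qed

lemma mult_in_state_image:
  "\<lbrakk>x \<in> \<sigma> ` carrier A; y \<in> \<sigma> ` carrier A\<rbrakk> \<Longrightarrow> x \<otimes> y \<in> \<sigma> ` carrier A"
  unfolding mem_state_image_iff by (metis m_closed state_mult_image)

lemma imp_in_state_image:
  "\<lbrakk>x \<in> \<sigma> ` carrier A; y \<in> \<sigma> ` carrier A\<rbrakk> \<Longrightarrow> x \<leadsto> y \<in> \<sigma> ` carrier A"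
  unfolding mem_state_image_iff by (metis imp_closed state_imp_image)

lemma pow_in_state_image:
  fixes n :: nat
  assumes "x \<in> \<sigma> ` carrier A"
  shows "x [^] n \<in> \<sigma> ` carrier A"
proof (induction n)
  case 0
  show ?case by (simp add: mem_state_image_iff state_one)
next
  case (Suc n)
  then show ?case using mult_in_state_image[OF Suc.IH assms] by simp
qed

text \<open>Elements of \<open>G\<close> are fixed by \<sigma>, so monotonicity turns
  \<open>g \<preceq> z\<close> into \<open>g \<preceq> \<sigma> z\<close>: the same witness
  \<open>g\<close> serves for \<open>\<sigma> z\<close>.\<close>

lemma state_filter_up_closure:
  assumes G: "G \<subseteq> \<sigma> ` carrier A" "G \<noteq> {}" and mult: "\<And>x y. \<lbrakk>x \<in> G; y \<in> G\<rbrakk> \<Longrightarrow> x \<otimes> y \<in> G"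
  shows "state_filter A \<sigma> (up_closure G)"
  unfolding state_filter_def
proof (intro conjI ballI)
  have "G \<subseteq> carrier A" using G(1) by auto
  then show "bl_filter A (up_closure G)" using G(2) mult by (rule bl_filter_up_closure)
next
  fix z assume "z \<in> up_closure G"
  then obtain g where g: "g \<in> G" "g \<preceq> z" and z: "z \<in> carrier A"
    by (auto simp: up_closure_def)
  have "g \<in> carrier A" "\<sigma> g = g"
    using g(1) G(1) mem_state_image_iff by blast+
  then show "\<sigma> z \<in> up_closure G"
    using state_mono[OF g(2)] g(1) z by (auto simp: up_closure_def)
qed

lemma state_filter_powers:
  assumes "u \<in> \<sigma> ` carrier A"
  shows "state_filter A \<sigma> (up_closure (range (\<lambda>n :: nat. u [^] n)))"
proof (rule state_filter_up_closure)
  show "range (\<lambda>n :: nat. u [^] n) \<subseteq> \<sigma> ` carrier A"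
    using assms pow_in_state_image by blast
  have "u \<in> carrier A" using assms by auto
  then show "x \<otimes> y \<in> range (\<lambda>n :: nat. u [^] n)"
    if "x \<in> range (\<lambda>n :: nat. u [^] n)" "y \<in> range (\<lambda>n :: nat. u [^] n)" for x y
    using that by (auto simp: nat_pow_mult)
qed simp

lemma self_in_powers:
  assumes "u \<in> carrier A"
  shows "u \<in> up_closure (range (\<lambda>n :: nat. u [^] n))"
proof -
  have "u = u [^] (1 :: nat)" using assms by simp
  then have "u \<in> range (\<lambda>n :: nat. u [^] n)" by (rule range_eqI)
  then show ?thesis using assms le_refl unfolding up_closure_def by blast
qed

section \<open>Linearity of the image\<close>

lemma linear_state_image:
  assumes "state_subdirectly_irreducible A \<sigma>"
  shows "bl_linear (state_image A \<sigma>)"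
proof -
  obtain F where F: "state_filter A \<sigma> F" "F \<noteq> {\<one>}"
    and least: "\<And>G. state_filter A \<sigma> G \<Longrightarrow> G \<noteq> {\<one>} \<Longrightarrow> F \<subseteq> G"
    using assms unfolding state_subdirectly_irreducible_def by blast
  then obtain f where f: "f \<in> F" "f \<noteq> \<one>" "f \<in> carrier A"
    by (auto simp: state_filter_def bl_filter_def)
  \<comment> \<open>The state-filter generated by such a \<open>u\<close> contains \<open>u\<close>,
    hence is not \<open>{\<one>}\<close>. It therefore includes the least one, \<open>F\<close>, and
    in particular \<open>f\<close>.\<close>
  have power_le: "\<exists>n :: nat. u [^] n \<preceq> f" if "u \<in> \<sigma> ` carrier A" "u \<noteq> \<one>" for u
  proof -
    have "u \<in> carrier A" using that(1) by auto
    then have "F \<subseteq> up_closure (range (\<lambda>n :: nat. u [^] n))"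
      using that least state_filter_powers self_in_powers by blast
    then show ?thesis
      using f(1) by (auto simp: up_closure_def)
  qed
  have "x \<preceq> y \<or> y \<preceq> x" if xy: "x \<in> \<sigma> ` carrier A" "y \<in> \<sigma> ` carrier A" for x y
  proof (rule ccontr)
    assume incomparable: "\<not> (x \<preceq> y \<or> y \<preceq> x)"
    define u v where "u = x \<leadsto> y" and "v = y \<leadsto> x"
    have c: "x \<in> carrier A" "y \<in> carrier A" using xy by auto
    have uv: "u \<in> carrier A" "v \<in> carrier A"
      using c by (simp_all add: u_def v_def imp_closed)
    have "u \<noteq> \<one>" "v \<noteq> \<one>"
      using incomparable le_iff_imp_eq_one c by (auto simp: u_def v_def)
    moreover have "u \<in> \<sigma> ` carrier A" "v \<in> \<sigma> ` carrier A"
      unfolding u_def v_def by (intro imp_in_state_image xy)+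
    ultimately obtain m n :: nat where mn: "u [^] m \<preceq> f" "v [^] n \<preceq> f"
      using power_le by meson
    \<comment> \<open>Prelinearity says \<open>u \<curlyvee> v = \<one>\<close>. The two factors are
      raised to powers one after the other, with the join commuted in between.\<close>
    have "(u [^] m) \<curlyvee> v = \<one>"
      using prelinearity[OF c] uv by (simp add: u_def v_def pow_join_eq_one)
    then have "(v [^] n) \<curlyvee> (u [^] m) = \<one>"
      using uv join_comm[of "u [^] m" v] by (simp add: pow_join_eq_one)
    \<comment> \<open>Both powers lie below \<open>f\<close>, so their join 1 does too, although
      \<open>f\<close> differs from 1.\<close>
    then have "\<one> \<preceq> f"
      using join_least[OF mn(2) mn(1)] uv f(3) by simp
    then show False
      using f by (simp add: one_le_iff)
  qed
  then show ?thesis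
    by (simp add: bl_linear_def state_image_def bl_le_def)
qed

section \<open>Filters of the image versus state-filters\<close>

lemma bl_filter_state_image_iff:
  "bl_filter (state_image A \<sigma>) G \<longleftrightarrow> G \<subseteq> \<sigma> ` carrier A \<and> G \<noteq> {} \<and>
    (\<forall>x\<in>G. \<forall>y\<in>G. x \<otimes> y \<in> G) \<and> (\<forall>x\<in>G. \<forall>y\<in>\<sigma> ` carrier A. x \<preceq> y \<longrightarrow> y \<in> G)"
  by (simp add: bl_filter_def state_image_def bl_le_def)

lemma up_closure_state_image_filter:
  assumes "bl_filter (state_image A \<sigma>) G" "G \<noteq> {\<one>}"
  shows "state_filter A \<sigma> (up_closure G)" "up_closure G \<noteq> {\<one>}"
proof -
  have G: "G \<subseteq> \<sigma> ` carrier A" "G \<noteq> {}" "\<And>x y. \<lbrakk>x \<in> G; y \<in> G\<rbrakk> \<Longrightarrow> x \<otimes> y \<in> G"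
    using assms(1) by (auto simp: bl_filter_state_image_iff)
  then show "state_filter A \<sigma> (up_closure G)"
    by (rule state_filter_up_closure)
  have "G \<subseteq> up_closure G" using G(1) by (intro subset_up_closure) auto
  then show "up_closure G \<noteq> {\<one>}"
    using G(2) assms(2) by (metis subset_singletonD)
qed

text \<open>For nontriviality, take \<open>f\<close> in \<open>F\<close> other than 1. Then
  \<open>\<sigma> f\<close> is in the trace, and it is not 1 because \<open>f\<close> is outside the
  kernel.\<close>

lemma trace_state_filter:
  assumes ker: "state_kernel A \<sigma> = {\<one>}" and F: "state_filter A \<sigma> F" "F \<noteq> {\<one>}"
  shows "bl_filter (state_image A \<sigma>) (F \<inter> \<sigma> ` carrier A)" "F \<inter> \<sigma> ` carrier A \<noteq> {\<one>}"
proof -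
  have fil: "bl_filter A F" using F(1) by (simp add: state_filter_def)
  have one: "\<one> \<in> F" "\<one> \<in> \<sigma> ` carrier A"
    using one_in_filter[OF fil] by (auto simp: mem_state_image_iff state_one)
  show "bl_filter (state_image A \<sigma>) (F \<inter> \<sigma> ` carrier A)"
    unfolding bl_filter_state_image_iff
  proof (intro conjI ballI impI)
    show "F \<inter> \<sigma> ` carrier A \<noteq> {}" using one by blast
  next
    fix x y assume "x \<in> F \<inter> \<sigma> ` carrier A" "y \<in> F \<inter> \<sigma> ` carrier A"
    then show "x \<otimes> y \<in> F \<inter> \<sigma> ` carrier A"
      using fil mult_in_state_image unfolding bl_filter_def by blast
  next
    fix x y assume "x \<in> F \<inter> \<sigma> ` carrier A" "y \<in> \<sigma> ` carrier A" "x \<preceq> y"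
    then show "y \<in> F \<inter> \<sigma> ` carrier A"
      using fil mem_state_image_iff unfolding bl_filter_def by blast
  qed simp
  obtain f where f: "f \<in> F" "f \<noteq> \<one>" "f \<in> carrier A"
    using F(2) fil one(1) by (auto simp: bl_filter_def)
  then have "\<sigma> f \<in> F \<inter> \<sigma> ` carrier A" "\<sigma> f \<noteq> \<one>"
    using F(1) ker by (auto simp: state_filter_def state_kernel_def)
  then show "F \<inter> \<sigma> ` carrier A \<noteq> {\<one>}" by blast
qed

lemma subdirectly_irreducible_state_image_iff:
  assumes ker: "state_kernel A \<sigma> = {\<one>}"
  shows "state_subdirectly_irreducible A \<sigma> \<longleftrightarrow> bl_subdirectly_irreducible (state_image A \<sigma>)"
proof
  have one: "\<one>\<^bsub>state_image A \<sigma>\<^esub> = \<one>" by (simp add: state_image_def)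
  {
    assume "state_subdirectly_irreducible A \<sigma>"
    then obtain F where F: "state_filter A \<sigma> F" "F \<noteq> {\<one>}"
      and least: "\<And>G. state_filter A \<sigma> G \<Longrightarrow> G \<noteq> {\<one>} \<Longrightarrow> F \<subseteq> G"
      unfolding state_subdirectly_irreducible_def by blast
    \<comment> \<open>The trace of the least state-filter is the least filter of the image: a
      \<open>z\<close> in it lies above some element of \<open>G\<close>, and \<open>G\<close> is
      upward closed within the image.\<close>
    have "F \<inter> \<sigma> ` carrier A \<subseteq> G" if G: "bl_filter (state_image A \<sigma>) G" "G \<noteq> {\<one>}" for G
    proof
      fix z assume z: "z \<in> F \<inter> \<sigma> ` carrier A"
      then have "z \<in> up_closure G"
        using least up_closure_state_image_filter[OF G] by blast
      then show "z \<in> G"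
        using z G(1) unfolding up_closure_def bl_filter_state_image_iff by blast
    qed
    then show "bl_subdirectly_irreducible (state_image A \<sigma>)"
      unfolding bl_subdirectly_irreducible_def one using trace_state_filter[OF ker F] by blast
  next
    assume "bl_subdirectly_irreducible (state_image A \<sigma>)"
    then obtain G where G: "bl_filter (state_image A \<sigma>) G" "G \<noteq> {\<one>}"
      and least: "\<And>H. bl_filter (state_image A \<sigma>) H \<Longrightarrow> H \<noteq> {\<one>} \<Longrightarrow> G \<subseteq> H"
      unfolding bl_subdirectly_irreducible_def one by blast
    \<comment> \<open>Conversely, the least filter \<open>G\<close> of the image lies in the trace
      of every nontrivial state-filter \<open>F\<close>, and \<open>F\<close> is upward closed in
      \<open>A\<close>.\<close>
    have "up_closure G \<subseteq> F" if F: "state_filter A \<sigma> F" "F \<noteq> {\<one>}" for F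
    proof -
      have "G \<subseteq> F"
        using least[OF trace_state_filter[OF ker F]] by blast
      then show ?thesis
        using F(1) unfolding up_closure_def state_filter_def bl_filter_def by blast
    qed
    then show "state_subdirectly_irreducible A \<sigma>"
      unfolding state_subdirectly_irreducible_def
      using up_closure_state_image_filter[OF G] by blast
  }
qed

end

theorem theorem5p5:
  fixes A :: "('a, 'm) bl_structure_scheme" and \<sigma> :: "'a \<Rightarrow> 'a"
  assumes "state_bl_algebra A \<sigma>"
  shows "(state_subdirectly_irreducible A \<sigma> \<longrightarrow> bl_linear (state_image A \<sigma>)) \<and>
         (state_kernel A \<sigma> = {\<one>\<^bsub>A\<^esub>} \<longrightarrow>
           (state_subdirectly_irreducible A \<sigma> \<longleftrightarrow>
            bl_subdirectly_irreducible (state_image A \<sigma>)))"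
proof -
  interpret state_bl_algebra A \<sigma> by (rule assms)
  show ?thesis
    using linear_state_image subdirectly_irreducible_state_image_iff by blast
qed

end
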